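(* Let $0<\alpha<1$, $\lambda\in\mathbb{C}\setminus\{0\}$, $T>0$, $w_0\in C^2([-1,1],\mathbb{C})$ and $h\in C([0,T]\times[-1,1],\mathbb{C})$ such that $\partial_y h\in C([0,T]\times[-1,1],\mathbb{C})$. Suppose further that $w_0(0)=0$ and $h(t,0)=0$ for $0\le t\le T$. Then, after possibly replacing $T$ by a smaller positive number, there exists a solution $w\in C^1([0,T]\times[-1,1],\mathbb{C})$ of $$\begin{cases} w_t=\lambda|w|^\alpha w+h, & 0\le t\le T,\ -1\le y\le 1,\\ w(0,y)=w_0(y), & -1\le y\le 1.\end{cases}$$ If $w_0'(0)\ne0$ and $$\int_0^\tau \sup_{0<|y|\le1}\frac{|\partial_y h(t,y)-\partial_y h(t,0)|}{|y|^\beta}\,dt<\infty$$ for some $0<\tau\le T$ and some $\beta>\alpha$, then $$\liminf_{|y|\downarrow0}\frac{|\partial_y w(t,y)-\partial_y w(t,0)|}{|y|^\alpha}>0$$ for all sufficiently small $t>0$. In particular, $w(t,\cdot)$ is not twice differentiable at $y=0$ for any sufficiently small $0<t\le T$.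
   Context: Functions are complex-valued; $t$ is the time variable and $y\in[-1,1]$ the space variable, and differentiability is in the real sense. *)

theory Defs
  imports "HOL-Analysis.Analysis"
begin

text \<open>
  Functions on \<open>[0,T] \<times> [-1,1]\<close> are curried total functions of type \<open>real \<Rightarrow> real \<Rightarrow> complex\<close>, time
  variable first; their values off the rectangle are irrelevant. Derivatives are taken within the
  closed intervals, hence are one-sided at the end points. Real differentiability of a
  complex-valued function of one real variable is \<^const>\<open>differentiable\<close>, with the derivative
  given by \<^const>\<open>vector_derivative\<close>.
\<close>

abbreviation rect :: "real \<Rightarrow> (real \<times> real) set" where
  "rect T \<equiv> {0..T} \<times> {-1..1}"

definition dt :: "real \<Rightarrow> (real \<Rightarrow> real \<Rightarrow> complex) \<Rightarrow> real \<Rightarrow> real \<Rightarrow> complex" where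
  "dt T u t y = vector_derivative (\<lambda>s. u s y) (at t within {0..T})"

definition dy :: "(real \<Rightarrow> real \<Rightarrow> complex) \<Rightarrow> real \<Rightarrow> real \<Rightarrow> complex" where
  "dy u t y = vector_derivative (u t) (at y within {-1..1})"

definition C0_rect :: "real \<Rightarrow> (real \<Rightarrow> real \<Rightarrow> complex) \<Rightarrow> bool" where
  "C0_rect T u \<longleftrightarrow> continuous_on (rect T) (\<lambda>(t, y). u t y)"

definition dt_C0_rect :: "real \<Rightarrow> (real \<Rightarrow> real \<Rightarrow> complex) \<Rightarrow> bool" where
  "dt_C0_rect T u \<longleftrightarrow>
     (\<forall>(t, y) \<in> rect T. (\<lambda>s. u s y) differentiable (at t within {0..T})) \<and> C0_rect T (dt T u)"

definition dy_C0_rect :: "real \<Rightarrow> (real \<Rightarrow> real \<Rightarrow> complex) \<Rightarrow> bool" where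
  "dy_C0_rect T u \<longleftrightarrow>
     (\<forall>(t, y) \<in> rect T. u t differentiable (at y within {-1..1})) \<and> C0_rect T (dy u)"

definition C1_rect :: "real \<Rightarrow> (real \<Rightarrow> real \<Rightarrow> complex) \<Rightarrow> bool" where
  "C1_rect T u \<longleftrightarrow> C0_rect T u \<and> dt_C0_rect T u \<and> dy_C0_rect T u"

definition C2_on :: "real set \<Rightarrow> (real \<Rightarrow> complex) \<Rightarrow> bool" where
  "C2_on S f \<longleftrightarrow>
     (\<exists>f' f''. (\<forall>y\<in>S. (f has_vector_derivative f' y) (at y within S)) \<and>
               (\<forall>y\<in>S. (f' has_vector_derivative f'' y) (at y within S)) \<and>
               continuous_on S f'')"

definition twice_differentiable_at :: "(real \<Rightarrow> complex) \<Rightarrow> real \<Rightarrow> bool" where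
  "twice_differentiable_at f x \<longleftrightarrow>
     (\<forall>\<^sub>F y in nhds x. f differentiable (at y)) \<and>
     (\<lambda>y. vector_derivative f (at y)) differentiable (at x)"

text \<open>For \<open>z = 0\<close> the convention \<open>0 powr \<alpha> = 0\<close> gives the right value of \<open>|z|\<^sup>\<alpha>\<close>, as \<open>\<alpha> > 0\<close>.\<close>

definition is_solution ::
  "real \<Rightarrow> complex \<Rightarrow> real \<Rightarrow> (real \<Rightarrow> complex) \<Rightarrow> (real \<Rightarrow> real \<Rightarrow> complex) \<Rightarrow>
   (real \<Rightarrow> real \<Rightarrow> complex) \<Rightarrow> bool" where
  "is_solution \<alpha> lam T w0 h w \<longleftrightarrow>
     C1_rect T w \<and>
     (\<forall>t\<in>{0..T}. \<forall>y\<in>{-1..1}.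
        dt T w t y = lam * of_real (cmod (w t y) powr \<alpha>) * w t y + h t y) \<and>
     (\<forall>y\<in>{-1..1}. w 0 y = w0 y)"

end

theory Submission
  imports Defs
begin

text \<open>
  With \<open>f(z) = \<lambda>|z|\<^sup>\<alpha>z\<close>, which is \<open>C\<^sup>1\<close> in the real sense, the solution \<open>w\<close> and its space derivative
  \<open>v\<close> are found by contraction on a short time interval, \<open>v\<close> from the linearized equation
  \<open>v\<^sub>t = f'(w)v + h\<^sub>y\<close>. By uniqueness \<open>w(t,0) = 0\<close>, hence
  \<open>v(t,y) - v(t,0)\<close> is the sum of \<open>w\<^sub>0'(y) - w\<^sub>0'(0)\<close> and of the integrals over \<open>0 \<le> s \<le> t\<close> of
  \<open>f'(w)v\<close> and of \<open>h\<^sub>y(s,y) - h\<^sub>y(s,0)\<close>.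
  The first difference is \<open>O(|y|)\<close> and the last integral \<open>O(|y|\<^sup>\<beta>)\<close>, both \<open>o(|y|\<^sup>\<alpha>)\<close>. As \<open>f'\<close> is
  homogeneous of degree \<open>\<alpha>\<close> and even, \<open>f'(w)v = |y|\<^sup>\<alpha> f'(w/y)v\<close>, where \<open>w/y\<close> and \<open>v\<close> are both
  close to \<open>a = w\<^sub>0'(0)\<close>. So the middle integral is close to
  \<open>t|y|\<^sup>\<alpha> f'(a)a = t|y|\<^sup>\<alpha> (1 + \<alpha>)\<lambda>|a|\<^sup>\<alpha>a\<close>, which is not \<open>o(|y|\<^sup>\<alpha>)\<close>.
\<close>

section \<open>Continuity and boundedness on the rectangle\<close>

text \<open>The substitution \<open>s = t * \<sigma>\<close> moves the variable upper limit into the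
  integrand. What remains is an integral over the fixed interval \<open>{0..1}\<close> with
  parameters \<open>t\<close> and \<open>y\<close>, to which continuous dependence on parameters
  applies.\<close>

lemma continuous_on_integral_upto:
  fixes G :: "real \<Rightarrow> 'p::topological_space \<Rightarrow> 'b::banach"
  assumes "continuous_on ({0..T} \<times> S) (\<lambda>(s, y). G s y)"
  shows "continuous_on ({0..T} \<times> S) (\<lambda>(t, y). integral {0..t} (\<lambda>s. G s y))"
proof -
  have eq: "integral {0..t} (\<lambda>s. G s y) = t *\<^sub>R integral {0..1} (\<lambda>\<sigma>. G (t * \<sigma>) y)"
    if "0 \<le> t" for t y
  proof (cases "t = 0")
    case False
    then have "(\<lambda>x. x / t) ` {0..t} = {0..1}"
      using that by (auto simp: image_divide_atLeastAtMost)
    then show ?thesis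
      using integral_stretch_real[OF False, of 0 t "\<lambda>s. G s y"] False that by simp
  qed simp
  have "continuous_on (({0..T} \<times> S) \<times> cbox 0 1) (\<lambda>(p, \<sigma>). G (fst p * \<sigma>) (snd p))"
    unfolding split_beta
    by (rule continuous_on_compose2[OF assms[unfolded split_beta],
          of _ "\<lambda>z. (fst (fst z) * snd z, snd (fst z))", simplified])
      (auto intro!: continuous_intros intro: order_trans[OF mult_left_le])
  from integral_continuous_on_param[OF this]
  have "continuous_on ({0..T} \<times> S)
      (\<lambda>p. fst p *\<^sub>R integral {0..1} (\<lambda>\<sigma>. G (fst p * \<sigma>) (snd p)))"
    by (auto intro!: continuous_intros)
  then show ?thesis
    by (rule continuous_on_eq) (auto simp: eq)
qed

lemma continuous_on_rect_slice:
  assumes "C0_rect T u" "y \<in> {-1..1}"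
  shows "continuous_on {0..T} (\<lambda>s. u s y)"
  by (rule continuous_on_compose2[OF assms(1)[unfolded C0_rect_def split_beta],
        of _ "\<lambda>s. (s, y)", simplified])
    (use assms(2) in \<open>auto intro!: continuous_intros\<close>)

lemma C0_rect_subset:
  assumes "C0_rect T u" "T' \<le> T"
  shows "C0_rect T' u"
  using assms unfolding C0_rect_def by (elim continuous_on_subset) auto

lemma C0_rect_bound:
  assumes "C0_rect T u"
  obtains M where "0 \<le> M" "\<And>t y. t \<in> {0..T} \<Longrightarrow> y \<in> {-1..1} \<Longrightarrow> cmod (u t y) \<le> M"
proof -
  have "bounded ((\<lambda>(t, y). u t y) ` rect T)"
    by (intro compact_imp_bounded compact_continuous_image assms[unfolded C0_rect_def]
        compact_Times compact_Icc)
  then obtain M where "\<And>t y. t \<in> {0..T} \<Longrightarrow> y \<in> {-1..1} \<Longrightarrow> cmod (u t y) \<le> M"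
    unfolding bounded_iff by fastforce
  then show ?thesis
    \<comment> \<open>For \<open>T < 0\<close> the rectangle is empty and \<open>M\<close> may be
      negative.\<close>
    by (intro that[of "max M 0"]) (auto simp: max.coboundedI1)
qed

section \<open>Integral equations in time with the space variable as a parameter\<close>

text \<open>Banach's fixed point theorem in the sup norm, for all \<open>y\<close> at once, so that
  joint continuity in \<open>(t, y)\<close> comes for free. Letting \<open>F\<close> depend on the
  point of the rectangle covers both the equation for \<open>w\<close> and the linearized one, whose
  coefficient is a function of \<open>(t, y)\<close>.\<close>

lemma picard_rect:
  fixes F :: "real \<times> real \<Rightarrow> complex \<Rightarrow> complex"
  assumes T: "0 \<le> T" and L: "0 \<le> L" "L * T < 1"
    and g: "continuous_on {-1..1} g"
    and F: "continuous_on (rect T \<times> UNIV) (\<lambda>(p, z). F p z)"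
    and lip: "\<And>p z z'. p \<in> rect T \<Longrightarrow> cmod (F p z - F p z') \<le> L * cmod (z - z')"
  obtains u where "C0_rect T u"
    "\<And>t y. t \<in> {0..T} \<Longrightarrow> y \<in> {-1..1} \<Longrightarrow>
       u t y = g y + integral {0..t} (\<lambda>s. F (s, y) (u s y))"
proof -
  let ?a = "(0, -1) :: real \<times> real" and ?b = "(T, 1) :: real \<times> real"
  have box: "cbox ?a ?b = rect T"
    by (auto simp: cbox_Pair_eq)
  have clamp: "clamp ?a ?b p \<in> rect T" for p
    unfolding box[symmetric] using T by (intro clamp_in_interval) (auto simp: Basis_prod_def)
  define \<Phi> where "\<Phi> u = (\<lambda>(t, y). g y + integral {0..t} (\<lambda>s. F (s, y) (u (s, y))))"
    for u :: "real \<times> real \<Rightarrow> complex"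
  have integrand: "continuous_on (rect T) (\<lambda>(s, y). F (s, y) (u (s, y)))"
    if "continuous_on (rect T) u" for u
  proof -
    have "continuous_on (rect T) (\<lambda>p. F (fst (p, u p)) (snd (p, u p)))"
      by (rule continuous_on_compose2[OF F[unfolded split_beta]])
        (auto intro!: continuous_intros that)
    then show ?thesis by (simp add: split_beta)
  qed
  have cont: "continuous_on (rect T) (\<Phi> u)" if u: "continuous_on (rect T) u" for u
  proof -
    have "continuous_on (rect T) (\<lambda>p. g (snd p))"
      by (rule continuous_on_compose2[OF g]) (auto intro!: continuous_intros)
    from continuous_on_add[OF this continuous_on_integral_upto[OF integrand[OF u]]]
    show ?thesis
      by (simp add: \<Phi>_def split_beta)
  qed
  \<comment> \<open>Composition with \<open>clamp\<close>, a retraction of the plane onto the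
    rectangle, extends \<open>\<Phi> u\<close> to a bounded continuous function on the whole plane.
    Thus \<open>\<Phi>\<close> becomes a self-map \<open>\<Psi>\<close> of a complete metric space
    given by a type.\<close>
  have "\<exists>v :: (real \<times> real) \<Rightarrow>\<^sub>C complex. \<forall>x. v x = \<Phi> u (clamp ?a ?b x)"
    for u :: "(real \<times> real) \<Rightarrow>\<^sub>C complex"
    by (rule continuous_on_cbox_bcontfunE[of ?a ?b "\<Phi> u"])
      (use cont[of u] in \<open>auto simp: box\<close>)
  then obtain \<Psi> :: "((real \<times> real) \<Rightarrow>\<^sub>C complex) \<Rightarrow> ((real \<times> real) \<Rightarrow>\<^sub>C complex)"
    where \<Psi>: "\<And>u x. \<Psi> u x = \<Phi> u (clamp ?a ?b x)"
    by metis
  have "dist (\<Psi> u) (\<Psi> v) \<le> L * T * dist u v" for u v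
  proof (rule dist_bound)
    fix x
    obtain t y where ty: "clamp ?a ?b x = (t, y)" by fastforce
    then have t: "t \<in> {0..T}" and y: "y \<in> {-1..1}" using clamp[of x] by auto
    have sl: "continuous_on {0..t} (\<lambda>s. F (s, y) (u (s, y)))" for u :: "(real \<times> real) \<Rightarrow>\<^sub>C complex"
      using continuous_on_rect_slice[of T "\<lambda>s y. F (s, y) (u (s, y))" y] integrand[of u] y t
      by (auto simp: C0_rect_def intro: continuous_on_subset)
    have "dist (\<Psi> u x) (\<Psi> v x)
        = cmod (integral {0..t} (\<lambda>s. F (s, y) (u (s, y)) - F (s, y) (v (s, y))))"
      by (simp add: \<Psi> ty \<Phi>_def dist_norm integral_diff integrable_continuous_real sl)
    also have "\<dots> \<le> L * dist u v * (t - 0)"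
    proof (rule integral_bound)
      fix s assume "s \<in> {0..t}"
      then have "(s, y) \<in> rect T" using t y by auto
      from lip[OF this, of "u (s, y)" "v (s, y)"]
      show "cmod (F (s, y) (u (s, y)) - F (s, y) (v (s, y))) \<le> L * dist u v"
        using mult_left_mono[OF dist_bounded[of u "(s, y)" v] L(1)] by (simp add: dist_norm)
    qed (use t in \<open>auto intro!: continuous_intros sl\<close>)
    also have "\<dots> \<le> L * T * dist u v"
      using mult_left_mono[of t T "L * dist u v"] t L(1) by (simp add: ac_simps)
    finally show "dist (\<Psi> u x) (\<Psi> v x) \<le> L * T * dist u v" .
  qed
  then have "\<exists>!u. \<Psi> u = u"
    using T L by (intro banach_fix_type[of "L * T"]) auto
  then obtain u where u: "\<Psi> u = u" by blast
  show ?thesis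
  proof (rule that[of "\<lambda>t y. u (t, y)"])
    show "C0_rect T (\<lambda>t y. u (t, y))"
      by (simp add: C0_rect_def split_beta)
    fix t y :: real assume "t \<in> {0..T}" "y \<in> {-1..1}"
    then have "clamp ?a ?b (t, y) = (t, y)"
      by (intro clamp_cancel_cbox) (simp add: box)
    then show "u (t, y) = g y + integral {0..t} (\<lambda>s. F (s, y) (u (s, y)))"
      using \<Psi>[of u "(t, y)"] by (simp add: u \<Phi>_def)
  qed
qed

text \<open>A substitute for Gronwall's inequality on short intervals. At a time \<open>r\<close>
  where \<open>norm (u r)\<close> is maximal, the integral is at most
  \<open>b * T + norm (u r) / 2\<close>, and the second term is absorbed into the left-hand side. It
  serves for the Lipschitz bound on \<open>w\<close>, for the differentiability of \<open>w\<close>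
  in \<open>y\<close>, and for \<open>w t 0 = 0\<close>.\<close>

lemma volterra_bound:
  fixes u g G :: "real \<Rightarrow> 'a::banach"
  assumes T: "0 \<le> T" and L: "0 \<le> L" "L * T \<le> 1 / 2" and b: "0 \<le> b"
    and u: "continuous_on {0..T} u" and G: "continuous_on {0..T} G"
    and eq: "\<And>t. t \<in> {0..T} \<Longrightarrow> u t = g t + integral {0..t} G"
    and ga: "\<And>t. t \<in> {0..T} \<Longrightarrow> norm (g t) \<le> a"
    and Gb: "\<And>t. t \<in> {0..T} \<Longrightarrow> norm (G t) \<le> b + L * norm (u t)"
    and t: "t \<in> {0..T}"
  shows "norm (u t) \<le> 2 * (a + b * T)"
proof -
  have "\<exists>r\<in>{0..T}. \<forall>s\<in>{0..T}. norm (u s) \<le> norm (u r)"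
    using continuous_attains_sup[OF compact_Icc _ continuous_on_norm[OF u]] T by auto
  then obtain r where r: "r \<in> {0..T}"
    and max: "\<And>s. s \<in> {0..T} \<Longrightarrow> norm (u s) \<le> norm (u r)"
    by blast
  have "norm (integral {0..r} G) \<le> (b + L * norm (u r)) * (r - 0)"
  proof (rule integral_bound)
    fix s assume "s \<in> {0..r}"
    then have s: "s \<in> {0..T}" using r by auto
    show "norm (G s) \<le> b + L * norm (u r)"
      using Gb[OF s] mult_left_mono[OF max[OF s] L(1)] by linarith
  qed (use r in \<open>auto intro: continuous_on_subset[OF G]\<close>)
  also have "\<dots> \<le> (b + L * norm (u r)) * T"
    using r b L by (intro mult_left_mono) auto
  also have "\<dots> \<le> b * T + norm (u r) / 2"
    using mult_right_mono[OF L(2), of "norm (u r)"] by (simp add: algebra_simps)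
  finally have "norm (u r) \<le> a + (b * T + norm (u r) / 2)"
    using eq[OF r] ga[OF r] norm_triangle_ineq[of "g r" "integral {0..r} G"] by simp
  then show ?thesis using max[OF t] by simp
qed

section \<open>First-order expansions with uniform error\<close>

text \<open>By compactness \<open>D\<close> is uniformly continuous with directions restricted to
  the unit sphere; linearity turns this into smallness of \<open>D p z - D p x\<close> in operator
  norm, and the mean value inequality concludes. The point is that \<open>d\<close> depends neither
  on \<open>p\<close> nor on \<open>x\<close>: the estimate is later needed at all times
  simultaneously.\<close>

lemma uniform_linearization:
  fixes f :: "'p::metric_space \<Rightarrow> 'a::euclidean_space \<Rightarrow> 'b::real_normed_vector"
  assumes P: "compact P" and S: "compact S" "convex S"
    and der: "\<And>p x. p \<in> P \<Longrightarrow> x \<in> S \<Longrightarrow> (f p has_derivative D p x) (at x within S)"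
    and cont: "continuous_on (P \<times> S \<times> sphere 0 1) (\<lambda>(p, x, v). D p x v)"
    and e: "0 < e"
  obtains d where "0 < d"
    "\<And>p x x'. p \<in> P \<Longrightarrow> x \<in> S \<Longrightarrow> x' \<in> S \<Longrightarrow> norm (x' - x) < d \<Longrightarrow>
       norm (f p x' - f p x - D p x (x' - x)) \<le> e * norm (x' - x)"
proof -
  have "uniformly_continuous_on (P \<times> S \<times> sphere 0 1) (\<lambda>(p, x, v). D p x v)"
    by (intro compact_uniformly_continuous cont compact_Times P S compact_sphere)
  then obtain d where d: "0 < d" and D: "\<And>z z'. z \<in> P \<times> S \<times> sphere 0 1 \<Longrightarrow>
      z' \<in> P \<times> S \<times> sphere 0 1 \<Longrightarrow> dist z' z < d \<Longrightarrow>
      dist ((\<lambda>(p, x, v). D p x v) z') ((\<lambda>(p, x, v). D p x v) z) < e"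
    using e unfolding uniformly_continuous_on_def by meson
  show ?thesis
  proof (rule that[OF d])
    fix p x x' assume p: "p \<in> P" and x: "x \<in> S" and x': "x' \<in> S" and near: "norm (x' - x) < d"
    \<comment> \<open>This set is convex, so it contains the segment from \<open>x\<close> to
      \<open>x'\<close>, and on it \<open>D\<close> stays within \<open>e\<close> of its value at
      \<open>x\<close> on unit vectors.\<close>
    let ?S = "S \<inter> ball x d"
    have "norm (f p x' - f p x - D p x (x' - x)) \<le> norm (x' - x) * e"
    proof (rule differentiable_bound_linearization[of _ _ ?S])
      fix t :: real assume t: "t \<in> {0..1}"
      have "convex ?S" using S by (intro convex_Int) auto
      moreover have "x \<in> ?S" "x' \<in> ?S"
        using x x' near d by (auto simp: dist_norm norm_minus_commute)
      ultimately have "(1 - t) *\<^sub>R x + t *\<^sub>R x' \<in> ?S"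
        using t by (intro convexD) auto
      then show "x + t *\<^sub>R (x' - x) \<in> ?S"
        by (simp add: algebra_simps)
    next
      fix z assume z: "z \<in> ?S"
      show "(f p has_derivative D p z) (at z within ?S)"
        using der[OF p, of z] z by (auto intro: has_derivative_subset)
      have lin: "linear (D p z)" "linear (D p x)"
        using der[OF p] z x by (auto intro: has_derivative_linear)
      show "onorm (D p z - D p x) \<le> e"
      proof (rule onorm_bound)
        fix v :: 'a
        show "norm ((D p z - D p x) v) \<le> e * norm v"
        proof (cases "v = 0")
          case True
          then show ?thesis using linear_0[OF lin(1)] linear_0[OF lin(2)] by simp
        next
          case False
          then have sgn: "sgn v \<in> sphere 0 1" by (simp add: norm_sgn)
          have v: "v = norm v *\<^sub>R sgn v" by (simp add: sgn_div_norm False)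
          have "dist (p, z, sgn v) (p, x, sgn v) < d"
            using z by (simp add: dist_Pair_Pair dist_commute)
          then have *: "norm (D p z (sgn v) - D p x (sgn v)) \<le> e"
            using D[of "(p, x, sgn v)" "(p, z, sgn v)"] p x z sgn by (auto simp: dist_norm)
          have "D p z v - D p x v = norm v *\<^sub>R (D p z (sgn v) - D p x (sgn v))"
            by (subst v, subst (2) v)
              (simp only: linear_cmul[OF lin(1)] linear_cmul[OF lin(2)] scaleR_right_diff_distrib)
          then show ?thesis
            using mult_right_mono[OF *, of "norm v"] by (simp add: ac_simps)
        qed
      qed (use e in simp)
    qed (use x d in auto)
    then show "norm (f p x' - f p x - D p x (x' - x)) \<le> e * norm (x' - x)"
      by (simp add: ac_simps)
  qed
qed

section \<open>The power nonlinearity and its real derivative\<close>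

text \<open>\<open>dpow a z\<close> is the real derivative of \<open>z \<mapsto> |z|\<^sup>a z\<close>. Written with \<open>sgn\<close>
  it has no singular factor \<open>|z|\<^sup>a\<^sup>-\<^sup>2\<close>, and it vanishes at \<open>z = 0\<close> as it should.\<close>

definition dpow :: "real \<Rightarrow> 'a::real_inner \<Rightarrow> 'a \<Rightarrow> 'a" where
  "dpow a z v = norm z powr a *\<^sub>R (v + (a * inner (sgn z) v) *\<^sub>R sgn z)"

lemma norm_dpow_le:
  assumes "0 \<le> a"
  shows "norm (dpow a z v) \<le> (1 + a) * norm z powr a * norm v"
proof -
  have "\<bar>inner (sgn z) v\<bar> * norm (sgn z) \<le> norm v"
    using Cauchy_Schwarz_ineq2[of "sgn z" v] by (auto simp: norm_sgn)
  then have "norm ((a * inner (sgn z) v) *\<^sub>R sgn z) \<le> a * norm v"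
    using mult_left_mono[OF _ assms] assms by (simp add: abs_mult mult.assoc)
  then have "norm (v + (a * inner (sgn z) v) *\<^sub>R sgn z) \<le> (1 + a) * norm v"
    using norm_triangle_ineq[of v "(a * inner (sgn z) v) *\<^sub>R sgn z"] by (simp add: algebra_simps)
  from mult_left_mono[OF this, of "norm z powr a"] show ?thesis
    by (simp add: dpow_def ac_simps)
qed

text \<open>The sign of \<open>c\<close> enters through both occurrences of \<open>sgn\<close> and
  cancels. This is the source of the factor \<open>\<bar>y\<bar> powr \<alpha>\<close> in the lower
  bound.\<close>

lemma dpow_scaleR_left:
  assumes "c \<noteq> 0"
  shows "dpow a (c *\<^sub>R z) v = \<bar>c\<bar> powr a *\<^sub>R dpow a z v"
  using assms by (simp add: dpow_def sgn_scaleR powr_mult sgn_real_def)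

text \<open>Euler's identity for a map that is positively homogeneous of degree
  \<open>1 + a\<close>.\<close>

lemma dpow_self: "dpow a z z = ((1 + a) * norm z powr a) *\<^sub>R z"
proof (cases "z = 0")
  case False
  then have "inner (sgn z) z = norm z"
    by (simp add: sgn_div_norm dot_square_norm power2_eq_square)
  with False show ?thesis
    by (simp add: dpow_def sgn_div_norm algebra_simps)
qed (simp add: dpow_def)

text \<open>The only delicate points have \<open>z = 0\<close>, where \<open>sgn\<close> jumps;
  there the bound \<open>norm_dpow_le\<close> tends to \<open>0\<close>, because
  \<open>a > 0\<close> and \<open>sgn\<close> is bounded.\<close>

lemma continuous_on_dpow:
  fixes A :: "('a::real_inner \<times> 'a) set"
  assumes a: "0 < a"
  shows "continuous_on A (\<lambda>(z, v). dpow a z v)"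
proof (rule continuous_at_imp_continuous_on, rule ballI)
  fix p :: "'a \<times> 'a"
  show "isCont (\<lambda>(z, v). dpow a z v) p"
  proof (cases "fst p = 0")
    case False
    have "(fst \<longlongrightarrow> fst p) (at p)" "(snd \<longlongrightarrow> snd p) (at p)"
      by (auto intro: tendsto_fst[OF tendsto_ident_at] tendsto_snd[OF tendsto_ident_at])
    with False show ?thesis
      unfolding split_beta dpow_def isCont_def
      by (intro tendsto_scaleR tendsto_powr tendsto_norm tendsto_add tendsto_mult tendsto_inner
          tendsto_sgn tendsto_const) simp_all
  next
    case True
    have "((\<lambda>q. (1 + a) * norm (fst q) powr a * norm (snd q)) \<longlongrightarrow>
        (1 + a) * norm (fst p) powr a * norm (snd p)) (at p)"
      using a
      by (intro tendsto_mult tendsto_powr' tendsto_norm tendsto_fst tendsto_snd tendsto_ident_at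
          tendsto_const) simp_all
    then have lim: "((\<lambda>q. (1 + a) * norm (fst q) powr a * norm (snd q)) \<longlongrightarrow> 0) (at p)"
      using True by simp
    have "((\<lambda>q. dpow a (fst q) (snd q)) \<longlongrightarrow> 0) (at p)"
    proof (rule Lim_null_comparison[OF _ lim])
      show "\<forall>\<^sub>F q in at p. norm (dpow a (fst q) (snd q)) \<le>
          (1 + a) * norm (fst q) powr a * norm (snd q)"
        using a by (intro always_eventually allI norm_dpow_le) simp
    qed
    moreover have "dpow a (fst p) (snd p) = 0"
      using True by (simp add: dpow_def)
    ultimately show ?thesis
      by (simp add: isCont_def case_prod_unfold)
  qed
qed

text \<open>Away from \<open>0\<close> this is the product rule; at \<open>0\<close> the difference
  quotient has norm \<open>norm h powr a\<close>, which tends to \<open>0\<close>.\<close>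

lemma has_derivative_norm_powr_scaleR:
  fixes z :: "'a::real_inner"
  assumes a: "0 < a"
  shows "((\<lambda>z. norm z powr a *\<^sub>R z) has_derivative dpow a z) (at z within S)"
proof (rule has_derivative_at_withinI, cases "z = 0")
  case False
  note [derivative_intros] = has_derivative_norm[OF False]
  show "((\<lambda>z. norm z powr a *\<^sub>R z) has_derivative dpow a z) (at z)"
    using False by (auto intro!: derivative_eq_intros ext
        simp: dpow_def sgn_div_norm scaleR_add_right inner_commute divide_inverse mult_ac)
next
  case True
  have "((\<lambda>h :: 'a. norm h powr a) \<longlongrightarrow> norm (0 :: 'a) powr a) (at 0)"
    using a by (intro tendsto_intros tendsto_powr') auto
  then have "((\<lambda>h :: 'a. norm h powr a) \<longlongrightarrow> 0) (at 0)"
    by simp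
  then have "((\<lambda>h :: 'a. norm (norm h powr a *\<^sub>R h) / norm h) \<longlongrightarrow> 0) (at 0)"
    by (rule Lim_transform_eventually) (auto simp: eventually_at_filter)
  moreover have "dpow a (0 :: 'a) = (\<lambda>v. 0)"
    by (auto simp: dpow_def)
  ultimately show "((\<lambda>z. norm z powr a *\<^sub>R z) has_derivative dpow a z) (at z)"
    using True by (simp add: has_derivative_at bounded_linear_zero)
qed

section \<open>Local existence and differentiability in space\<close>

lemma has_vector_derivative_lipschitz:
  fixes f :: "real \<Rightarrow> 'a::real_normed_vector"
  assumes "convex S"
    and der: "\<And>x. x \<in> S \<Longrightarrow> (f has_vector_derivative f' x) (at x within S)"
    and K: "\<And>x. x \<in> S \<Longrightarrow> norm (f' x) \<le> K" and "x \<in> S" "y \<in> S"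
  shows "norm (f y - f x) \<le> K * \<bar>y - x\<bar>"
proof -
  have "onorm (\<lambda>d. d *\<^sub>R f' z) \<le> K" if "z \<in> S" for z
    using K[OF that] order_trans[OF norm_ge_zero K[OF that]]
    by (intro onorm_bound) (auto simp: mult.commute[of K] intro: mult_left_mono)
  from differentiable_bound[OF assms(1) der[unfolded has_vector_derivative_def] this \<open>y \<in> S\<close> \<open>x \<in> S\<close>]
  show ?thesis by simp
qed

lemma dy_C0_rect_has_vector_derivative:
  assumes "dy_C0_rect T h" "t \<in> {0..T}" "y \<in> {-1..1}"
  shows "(h t has_vector_derivative dy h t y) (at y within {-1..1})"
  using assms vector_derivative_works unfolding dy_C0_rect_def dy_def by blast

text \<open>The candidate \<open>v\<close> for the space derivative is built from the linearized
  equation before \<open>w\<close> is known to be differentiable in \<open>y\<close>. That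
  \<open>v\<close> is the derivative follows by applying \<open>volterra_bound\<close> to the
  remainder \<open>w t y' - w t y - (y' - y) v t y\<close>.\<close>

lemma local_solution:
  fixes lam :: complex
  assumes \<alpha>: "0 < \<alpha>" and T: "0 < T"
    and w0: "\<And>y. y \<in> {-1..1} \<Longrightarrow> (w0 has_vector_derivative w0' y) (at y within {-1..1})"
    and w0': "continuous_on {-1..1} w0'"
    and h: "C0_rect T h" "dy_C0_rect T h"
    and zero: "w0 0 = 0" "\<And>t. t \<in> {0..T} \<Longrightarrow> h t 0 = 0"
  obtains T' w v where "0 < T'" "T' \<le> T" "C0_rect T' w" "C0_rect T' v"
    "\<And>t y. t \<in> {0..T'} \<Longrightarrow> y \<in> {-1..1} \<Longrightarrow>
       w t y = w0 y + integral {0..t} (\<lambda>s. lam * (cmod (w s y) powr \<alpha> *\<^sub>R w s y) + h s y)"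
    "\<And>t y. t \<in> {0..T'} \<Longrightarrow> y \<in> {-1..1} \<Longrightarrow>
       v t y = w0' y + integral {0..t} (\<lambda>s. lam * dpow \<alpha> (w s y) (v s y) + dy h s y)"
    "\<And>t y. t \<in> {0..T'} \<Longrightarrow> y \<in> {-1..1} \<Longrightarrow>
       (w t has_vector_derivative v t y) (at y within {-1..1})"
    "\<And>t. t \<in> {0..T'} \<Longrightarrow> w t 0 = 0"
proof -
  define f where "f z = lam * (cmod z powr \<alpha> *\<^sub>R z)" for z
  define f' where "f' z v = lam * dpow \<alpha> z v" for z v
  have cont_w0: "continuous_on {-1..1} w0"
    using w0 by (rule continuous_on_vector_derivative)
  have dyh: "C0_rect T (dy h)"
    using h(2) by (simp add: dy_C0_rect_def)
  note h_der = dy_C0_rect_has_vector_derivative[OF h(2)]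
  \<comment> \<open>The degenerate rectangle with \<open>T = 0\<close> makes
    \<open>C0_rect_bound\<close> available for functions of \<open>y\<close> alone.\<close>
  obtain M0 where M0: "0 \<le> M0" "\<And>y. y \<in> {-1..1} \<Longrightarrow> cmod (w0 y) \<le> M0"
  proof (rule C0_rect_bound[of 0 "\<lambda>_. w0"])
    show "C0_rect 0 (\<lambda>_. w0)"
      unfolding C0_rect_def split_beta
      by (rule continuous_on_compose2[OF cont_w0]) (auto intro!: continuous_intros)
  qed auto
  obtain K0 where K0: "0 \<le> K0" "\<And>y. y \<in> {-1..1} \<Longrightarrow> cmod (w0' y) \<le> K0"
  proof (rule C0_rect_bound[of 0 "\<lambda>_. w0'"])
    show "C0_rect 0 (\<lambda>_. w0')"
      unfolding C0_rect_def split_beta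
      by (rule continuous_on_compose2[OF w0']) (auto intro!: continuous_intros)
  qed auto
  obtain Mh where Mh: "0 \<le> Mh" "\<And>t y. t \<in> {0..T} \<Longrightarrow> y \<in> {-1..1} \<Longrightarrow> cmod (h t y) \<le> Mh"
    using C0_rect_bound[OF h(1)] by metis
  obtain K1 where K1: "0 \<le> K1" "\<And>t y. t \<in> {0..T} \<Longrightarrow> y \<in> {-1..1} \<Longrightarrow> cmod (dy h t y) \<le> K1"
    using C0_rect_bound[OF dyh] by metis
  \<comment> \<open>\<open>R\<close> leaves a margin of \<open>1\<close> above the initial data. On
    the ball of radius \<open>R\<close>, \<open>L\<close> is a Lipschitz constant of
    \<open>f\<close> and \<open>C\<close> bounds the right-hand side. \<open>T'\<close> is chosen so
    that \<open>C * T' \<le> 1\<close>, which keeps \<open>w\<close> in the ball, and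
    \<open>L * T' \<le> 1 / 2\<close>, as \<open>volterra_bound\<close> demands.\<close>
  define R where "R = M0 + 1"
  define L where "L = cmod lam * ((1 + \<alpha>) * R powr \<alpha>)"
  define C where "C = cmod lam * (R powr \<alpha> * R) + Mh"
  define T' where "T' = min T (1 / (C + 2 * L + 1))"
  have R: "0 < R" using M0 by (simp add: R_def)
  have L: "0 \<le> L" using \<alpha> by (simp add: L_def)
  have C: "0 \<le> C" using R Mh by (simp add: C_def)
  have T': "0 < T'" "T' \<le> T" using T L C by (auto simp: T'_def)
  have "(C + 2 * L + 1) * T' \<le> (C + 2 * L + 1) * (1 / (C + 2 * L + 1))"
    using L C by (intro mult_left_mono) (auto simp: T'_def)
  then have "C * T' + 2 * (L * T') + T' \<le> 1"
    using L C by (simp add: distrib_right)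
  moreover have "0 \<le> C * T'" "0 \<le> L * T'"
    using L C T' by auto
  ultimately have CT: "C * T' \<le> 1" and LT: "L * T' \<le> 1 / 2"
    using T'(1) by linarith+
  have f_der: "(f has_derivative f' z) (at z within S)" for z S
    unfolding f_def f'_def
    by (intro has_derivative_mult_right has_derivative_norm_powr_scaleR \<alpha>)
  have f'_lin: "linear (f' z)" for z
    using f_der by (rule has_derivative_linear)
  have f'_bound: "cmod (f' z v) \<le> L * cmod v" if "z \<in> cball 0 R" for z v
  proof -
    have "cmod z powr \<alpha> \<le> R powr \<alpha>"
      using that \<alpha> by (intro powr_mono2) auto
    then have "(1 + \<alpha>) * cmod z powr \<alpha> * cmod v \<le> (1 + \<alpha>) * R powr \<alpha> * cmod v"
      using \<alpha> by (intro mult_right_mono mult_left_mono) auto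
    then have "cmod (dpow \<alpha> z v) \<le> (1 + \<alpha>) * R powr \<alpha> * cmod v"
      using norm_dpow_le[of \<alpha> z v] \<alpha> by linarith
    from mult_left_mono[OF this, of "cmod lam"] show ?thesis
      by (simp add: f'_def L_def norm_mult mult.assoc)
  qed
  have f_lip: "cmod (f z - f z') \<le> L * cmod (z - z')"
    if "z \<in> cball 0 R" "z' \<in> cball 0 R" for z z'
    by (rule differentiable_bound[of "cball 0 R" f f'])
      (use that L f'_bound in \<open>auto intro!: f_der onorm_bound\<close>)
  have f_bound: "cmod (f z) \<le> cmod lam * (R powr \<alpha> * R)" if "z \<in> cball 0 R" for z
  proof -
    have "cmod z powr \<alpha> * cmod z \<le> R powr \<alpha> * R"
      using that \<alpha> R by (intro mult_mono powr_mono2) auto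
    from mult_left_mono[OF this, of "cmod lam"] show ?thesis
      by (simp add: f_def norm_mult ac_simps)
  qed
  have cont_f: "continuous_on S f" for S
    using f_der by (rule has_derivative_continuous_on)
  have cont_f': "continuous_on S (\<lambda>(z, v). f' z v)" for S
    unfolding f'_def case_prod_unfold
    by (intro continuous_on_mult_left continuous_on_dpow[OF \<alpha>, unfolded case_prod_unfold])
  have h': "C0_rect T' h" "C0_rect T' (dy h)"
    using h(1) dyh T'(2) by (auto intro: C0_rect_subset)

  \<comment> \<open>Composing \<open>f\<close> with the projection \<open>P\<close> onto the ball makes it globally Lipschitz; \<open>T'\<close> is so
     small that the solution of the truncated equation never leaves the ball.\<close>
  define P where "P = closest_point (cball (0 :: complex) R)"
  have P: "P z \<in> cball 0 R" for z
    unfolding P_def using R by (intro closest_point_in_set) auto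
  have cont_P: "continuous_on S P" for S
    unfolding P_def using R by (intro continuous_on_closest_point) auto
  obtain w where w: "C0_rect T' w"
    and w_eq_P: "\<And>t y. t \<in> {0..T'} \<Longrightarrow> y \<in> {-1..1} \<Longrightarrow>
      w t y = w0 y + integral {0..t} (\<lambda>s. f (P (w s y)) + h s y)"
  proof (rule picard_rect[of T' L w0 "\<lambda>(t, y) z. f (P z) + h t y"])
    have "continuous_on (rect T' \<times> UNIV) (\<lambda>q. f (P (snd q)) + h (fst (fst q)) (snd (fst q)))"
      by (intro continuous_on_add continuous_on_compose2[OF cont_f]
          continuous_on_compose2[OF cont_P]
          continuous_on_compose2[OF h'(1)[unfolded C0_rect_def case_prod_unfold]]
          continuous_intros) auto
    then show "continuous_on (rect T' \<times> UNIV) (\<lambda>(p, z). (case p of (t, y) \<Rightarrow> \<lambda>z. f (P z) + h t y) z)"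
      by (simp add: case_prod_unfold)
    fix p z z' assume "p \<in> rect T'"
    have "cmod (f (P z) - f (P z')) \<le> L * cmod (P z - P z')"
      by (intro f_lip P)
    also have "\<dots> \<le> L * cmod (z - z')"
      using closest_point_lipschitz[of "cball 0 R" z z'] R L
      by (intro mult_left_mono) (auto simp: P_def dist_norm)
    finally show "cmod ((case p of (t, y) \<Rightarrow> \<lambda>z. f (P z) + h t y) z
        - (case p of (t, y) \<Rightarrow> \<lambda>z. f (P z) + h t y) z') \<le> L * cmod (z - z')"
      by (simp add: case_prod_unfold)
  qed (use T' L LT cont_w0 in auto)
  note slice = continuous_on_rect_slice
  have w_ball: "w t y \<in> cball 0 R" if t: "t \<in> {0..T'}" and y: "y \<in> {-1..1}" for t y
  proof -
    have "cmod (integral {0..t} (\<lambda>s. f (P (w s y)) + h s y)) \<le> C * (t - 0)"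
    proof (rule integral_bound)
      show "continuous_on {0..t} (\<lambda>s. f (P (w s y)) + h s y)"
        using t
        by (intro continuous_on_add continuous_on_compose2[OF cont_f]
            continuous_on_compose2[OF cont_P] continuous_on_subset[OF slice[OF w y]]
            continuous_on_subset[OF slice[OF h'(1) y]]) auto
      fix s assume "s \<in> {0..t}"
      then have "cmod (h s y) \<le> Mh" using Mh t T' y by auto
      then show "cmod (f (P (w s y)) + h s y) \<le> C"
        using f_bound[OF P, of "w s y"] norm_triangle_ineq[of "f (P (w s y))" "h s y"]
        by (simp add: C_def)
    qed (use t in auto)
    also have "\<dots> \<le> C * T'" using t C by (intro mult_left_mono) auto
    finally show ?thesis
      using w_eq_P[OF t y] CT M0(2)[OF y]
        norm_triangle_ineq[of "w0 y" "integral {0..t} (\<lambda>s. f (P (w s y)) + h s y)"]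
      by (simp add: R_def)
  qed
  have w_eq: "w t y = w0 y + integral {0..t} (\<lambda>s. f (w s y) + h s y)"
    if t: "t \<in> {0..T'}" and y: "y \<in> {-1..1}" for t y
  proof -
    have "P (w s y) = w s y" if "s \<in> {0..t}" for s
      using w_ball[of s y] t y that unfolding P_def by (intro closest_point_self) auto
    then have "integral {0..t} (\<lambda>s. f (P (w s y)) + h s y) = integral {0..t} (\<lambda>s. f (w s y) + h s y)"
      by (intro Henstock_Kurzweil_Integration.integral_cong) simp
    then show ?thesis using w_eq_P[OF t y] by simp
  qed
  \<comment> \<open>With \<open>w\<close> known and confined to the ball, the equation is affine in
    the unknown with the same Lipschitz constant \<open>L\<close>, so it is solved without
    truncation.\<close>
  obtain v where v: "C0_rect T' v"
    and v_eq: "\<And>t y. t \<in> {0..T'} \<Longrightarrow> y \<in> {-1..1} \<Longrightarrow>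
      v t y = w0' y + integral {0..t} (\<lambda>s. f' (w s y) (v s y) + dy h s y)"
  proof (rule picard_rect[of T' L w0' "\<lambda>(t, y) z. f' (w t y) z + dy h t y"])
    have "continuous_on (rect T' \<times> UNIV)
        (\<lambda>q. (\<lambda>p. f' (fst p) (snd p)) (w (fst (fst q)) (snd (fst q)), snd q)
           + dy h (fst (fst q)) (snd (fst q)))"
      by (intro continuous_on_add continuous_on_compose2[OF cont_f'[of UNIV, unfolded case_prod_unfold]]
          continuous_on_Pair
          continuous_on_compose2[OF h'(2)[unfolded C0_rect_def case_prod_unfold]]
          continuous_on_compose2[OF w[unfolded C0_rect_def case_prod_unfold]]
          continuous_intros) auto
    then show "continuous_on (rect T' \<times> UNIV)
        (\<lambda>(p, z). (case p of (t, y) \<Rightarrow> \<lambda>z. f' (w t y) z + dy h t y) z)"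
      by (simp add: case_prod_unfold)
    fix p z z' assume "p \<in> rect T'"
    then show "cmod ((case p of (t, y) \<Rightarrow> \<lambda>z. f' (w t y) z + dy h t y) z
        - (case p of (t, y) \<Rightarrow> \<lambda>z. f' (w t y) z + dy h t y) z') \<le> L * cmod (z - z')"
      using f'_bound[OF w_ball, of "fst p" "snd p" "z - z'"]
      by (auto simp: case_prod_unfold linear_diff[OF f'_lin])
  qed (use T' L LT w0' in auto)

  have cont_G: "continuous_on {0..T'} (\<lambda>s. f (w s y) + h s y)" if "y \<in> {-1..1}" for y
    by (intro continuous_on_add continuous_on_compose2[OF cont_f] slice[OF w that]
        slice[OF h'(1) that]) auto
  have cont_G': "continuous_on {0..T'} (\<lambda>s. f' (w s y) (v s y) + dy h s y)"
    if y: "y \<in> {-1..1}" for y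
  proof -
    have "continuous_on {0..T'} (\<lambda>s. (\<lambda>p. f' (fst p) (snd p)) (w s y, v s y))"
      by (intro continuous_on_compose2[OF cont_f'[of UNIV, unfolded case_prod_unfold]]
          continuous_on_Pair slice[OF w y] slice[OF v y]) auto
    then show ?thesis
      by (auto intro!: continuous_on_add slice[OF h'(2) y])
  qed
  have integrable: "g integrable_on {0..t}" if "continuous_on {0..T'} g" "t \<in> {0..T'}"
    for g :: "real \<Rightarrow> complex" and t
    using that by (intro integrable_continuous_real) (auto intro: continuous_on_subset)

  \<comment> \<open>The Lipschitz bound turns errors of order \<open>o(w s y' - w s y)\<close> into \<open>o(y' - y)\<close>.\<close>
  define K where "K = 2 * (K0 + K1 * T')"
  have K: "0 \<le> K" using K0 K1 T' by (simp add: K_def)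
  have w_lip: "cmod (w t y' - w t y) \<le> K * \<bar>y' - y\<bar>"
    if t: "t \<in> {0..T'}" and y: "y \<in> {-1..1}" and y': "y' \<in> {-1..1}" for t y y'
  proof -
    have "cmod (w t y' - w t y) \<le> 2 * (K0 * \<bar>y' - y\<bar> + K1 * \<bar>y' - y\<bar> * T')"
    proof (rule volterra_bound[where u = "\<lambda>s. w s y' - w s y" and g = "\<lambda>_. w0 y' - w0 y"
          and G = "\<lambda>s. (f (w s y') + h s y') - (f (w s y) + h s y)"])
      show "w s y' - w s y = w0 y' - w0 y + integral {0..s}
          (\<lambda>s. (f (w s y') + h s y') - (f (w s y) + h s y))" if s: "s \<in> {0..T'}" for s
        using w_eq[OF s y] w_eq[OF s y']
        by (simp add: Henstock_Kurzweil_Integration.integral_diff[OF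
            integrable[OF cont_G[OF y'] s] integrable[OF cont_G[OF y] s]])
      show "cmod (w0 y' - w0 y) \<le> K0 * \<bar>y' - y\<bar>"
        by (rule has_vector_derivative_lipschitz[OF _ w0 K0(2)]) (use y y' in auto)
      fix s assume s: "s \<in> {0..T'}"
      then have "cmod (h s y' - h s y) \<le> K1 * \<bar>y' - y\<bar>"
        using T' y y'
        by (intro has_vector_derivative_lipschitz[OF _ h_der K1(2)]) auto
      then show "cmod ((f (w s y') + h s y') - (f (w s y) + h s y))
          \<le> K1 * \<bar>y' - y\<bar> + L * cmod (w s y' - w s y)"
        using f_lip[OF w_ball[OF s y'] w_ball[OF s y]]
          norm_triangle_ineq[of "f (w s y') - f (w s y)" "h s y' - h s y"]
        by (simp add: algebra_simps)
    qed (use T' L LT K1 t in \<open>auto intro!: continuous_on_diff slice[OF w] cont_G y y'\<close>)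
    then show ?thesis by (simp add: K_def algebra_simps)
  qed

  have w_der: "(w t has_vector_derivative v t y) (at y within {-1..1})"
    if t: "t \<in> {0..T'}" and y: "y \<in> {-1..1}" for t y
    unfolding has_vector_derivative_def has_derivative_within_alt
  proof (intro conjI allI impI)
    show "bounded_linear (\<lambda>x. x *\<^sub>R v t y)"
      by (rule bounded_linear_scaleR_left)
    fix e :: real assume e: "0 < e"
    \<comment> \<open>Below, \<open>volterra_bound\<close> is applied with
      \<open>a = \<epsilon> * k\<close> and \<open>b = \<epsilon> * (K + 1) * k\<close>, where
      \<open>k = \<bar>y' - y\<bar>\<close>. It yields \<open>\<epsilon> * c * k\<close>, which
      equals \<open>e * k\<close>.\<close>
    define c where "c = 2 * (1 + (K + 1) * T')"
    have c: "0 < c" using K T' by (simp add: c_def add_pos_nonneg)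
    define \<epsilon> where "\<epsilon> = e / c"
    have \<epsilon>: "0 < \<epsilon>" using e c by (simp add: \<epsilon>_def)
    \<comment> \<open>Since \<open>f\<close> does not depend on time, the parameter set is a single
      dummy point.\<close>
    obtain d1 where d1: "0 < d1" "\<And>z z'. z \<in> cball 0 R \<Longrightarrow> z' \<in> cball 0 R \<Longrightarrow>
        cmod (z' - z) < d1 \<Longrightarrow> cmod (f z' - f z - f' z (z' - z)) \<le> \<epsilon> * cmod (z' - z)"
    proof (rule uniform_linearization[of "{0 :: real}" "cball 0 R" "\<lambda>_. f" "\<lambda>_. f'" \<epsilon>])
      have "continuous_on ({0 :: real} \<times> cball 0 R \<times> sphere 0 1)
          (\<lambda>q. (\<lambda>p. f' (fst p) (snd p)) (snd q))"
        by (intro continuous_on_compose2[OF cont_f'[of UNIV, unfolded case_prod_unfold]]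
            continuous_intros) auto
      then show "continuous_on ({0 :: real} \<times> cball 0 R \<times> sphere 0 1) (\<lambda>(p, x, v). f' x v)"
        by (simp add: case_prod_unfold)
    qed (use \<epsilon> f_der in auto)
    obtain d2 where d2: "0 < d2" "\<And>s y y'. s \<in> {0..T'} \<Longrightarrow> y \<in> {-1..1} \<Longrightarrow> y' \<in> {-1..1} \<Longrightarrow>
        \<bar>y' - y\<bar> < d2 \<Longrightarrow> cmod (h s y' - h s y - (y' - y) *\<^sub>R dy h s y) \<le> \<epsilon> * \<bar>y' - y\<bar>"
    proof (rule uniform_linearization[of "{0..T'}" "{-1..1}" h "\<lambda>s y k. k *\<^sub>R dy h s y" \<epsilon>])
      have "continuous_on ({0..T'} \<times> {-1..1} \<times> sphere (0 :: real) 1)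
          (\<lambda>q. snd (snd q) *\<^sub>R (\<lambda>p. dy h (fst p) (snd p)) (fst q, fst (snd q)))"
        by (intro continuous_on_scaleR
            continuous_on_compose2[OF h'(2)[unfolded C0_rect_def case_prod_unfold]]
            continuous_intros) auto
      then show "continuous_on ({0..T'} \<times> {-1..1} \<times> sphere 0 1) (\<lambda>(s, y, k). k *\<^sub>R dy h s y)"
        by (simp add: case_prod_unfold)
    qed (use \<epsilon> h_der T' in \<open>auto simp: has_vector_derivative_def\<close>)
    obtain d3 where d3: "0 < d3" "\<And>y'. y' \<in> {-1..1} \<Longrightarrow> \<bar>y' - y\<bar> < d3 \<Longrightarrow>
        cmod (w0 y' - w0 y - (y' - y) *\<^sub>R w0' y) \<le> \<epsilon> * \<bar>y' - y\<bar>"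
      using w0[OF y, unfolded has_vector_derivative_def has_derivative_within_alt] \<epsilon>
      by (metis real_norm_def)
    \<comment> \<open>The first entry ensures \<open>K * \<bar>y' - y\<bar> < d1\<close>, so that
      \<open>w s y'\<close> is close enough to \<open>w s y\<close> for the expansion of
      \<open>f\<close>; \<open>K + 1\<close> avoids division by zero.\<close>
    define d where "d = min (d1 / (K + 1)) (min d2 d3)"
    have d: "0 < d" using d1(1) d2(1) d3(1) K by (simp add: d_def)
    have "cmod (w t y' - w t y - (y' - y) *\<^sub>R v t y) \<le> e * \<bar>y' - y\<bar>"
      if y': "y' \<in> {-1..1}" and near: "\<bar>y' - y\<bar> < d" for y'
    proof -
      let ?k = "\<bar>y' - y\<bar>"
      have "(K + 1) * ?k < d1"
        using near K by (simp add: d_def pos_less_divide_eq mult.commute)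
      then have Kk: "K * ?k < d1" using K by (simp add: distrib_right)
      have "cmod (w t y' - w t y - (y' - y) *\<^sub>R v t y) \<le> 2 * (\<epsilon> * ?k + \<epsilon> * (K + 1) * ?k * T')"
      proof (rule volterra_bound[where u = "\<lambda>s. w s y' - w s y - (y' - y) *\<^sub>R v s y"
            and g = "\<lambda>_. w0 y' - w0 y - (y' - y) *\<^sub>R w0' y"
            and G = "\<lambda>s. (f (w s y') + h s y') - (f (w s y) + h s y)
              - (y' - y) *\<^sub>R (f' (w s y) (v s y) + dy h s y)"])
        show "w s y' - w s y - (y' - y) *\<^sub>R v s y = w0 y' - w0 y - (y' - y) *\<^sub>R w0' y +
            integral {0..s} (\<lambda>s. (f (w s y') + h s y') - (f (w s y) + h s y)
              - (y' - y) *\<^sub>R (f' (w s y) (v s y) + dy h s y))" if s: "s \<in> {0..T'}" for s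
        proof -
          note int = integrable[OF cont_G[OF y'] s] integrable[OF cont_G[OF y] s]
            integrable[OF cont_G'[OF y] s]
          have "integral {0..s} (\<lambda>s. (f (w s y') + h s y') - (f (w s y) + h s y)
              - (y' - y) *\<^sub>R (f' (w s y) (v s y) + dy h s y))
            = integral {0..s} (\<lambda>s. f (w s y') + h s y') - integral {0..s} (\<lambda>s. f (w s y) + h s y)
              - (y' - y) *\<^sub>R integral {0..s} (\<lambda>s. f' (w s y) (v s y) + dy h s y)"
            by (simp only: Henstock_Kurzweil_Integration.integral_diff
                Henstock_Kurzweil_Integration.integral_cmul int integrable_diff integrable_cmul)
          then show ?thesis
            unfolding w_eq[OF s y] w_eq[OF s y'] v_eq[OF s y] by (simp add: algebra_simps)
        qed
        show "cmod (w0 y' - w0 y - (y' - y) *\<^sub>R w0' y) \<le> \<epsilon> * ?k"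
          using d3(2)[OF y'] near by (simp add: d_def)
        fix s assume s: "s \<in> {0..T'}"
        let ?\<delta> = "w s y' - w s y"
        have "cmod (f (w s y') - f (w s y) - f' (w s y) ?\<delta>) \<le> \<epsilon> * cmod ?\<delta>"
          using w_lip[OF s y y'] Kk by (intro d1(2) w_ball s y y') simp
        also have "\<dots> \<le> \<epsilon> * (K * ?k)"
          using w_lip[OF s y y'] \<epsilon> by (intro mult_left_mono) auto
        finally have 1: "cmod (f (w s y') - f (w s y) - f' (w s y) ?\<delta>) \<le> \<epsilon> * (K * ?k)" .
        have 2: "cmod (h s y' - h s y - (y' - y) *\<^sub>R dy h s y) \<le> \<epsilon> * ?k"
          using d2(2)[OF s y y'] near by (simp add: d_def)
        have 3: "cmod (f' (w s y) (?\<delta> - (y' - y) *\<^sub>R v s y)) \<le> L * cmod (?\<delta> - (y' - y) *\<^sub>R v s y)"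
          by (intro f'_bound w_ball s y)
        \<comment> \<open>The integrand splits into the linearization errors of \<open>f\<close> and
          \<open>h\<close> and the linear map \<open>f' (w s y)\<close> applied to the unknown
          remainder; the last piece is the term \<open>L * norm (u t)\<close> of
          \<open>volterra_bound\<close>.\<close>
        have eq: "(f (w s y') + h s y') - (f (w s y) + h s y) - (y' - y) *\<^sub>R (f' (w s y) (v s y) + dy h s y)
          = (f (w s y') - f (w s y) - f' (w s y) ?\<delta>) + (h s y' - h s y - (y' - y) *\<^sub>R dy h s y)
            + f' (w s y) (?\<delta> - (y' - y) *\<^sub>R v s y)"
          by (simp add: linear_diff[OF f'_lin] linear_cmul[OF f'_lin] scaleR_add_right)
        have "cmod ((f (w s y') + h s y') - (f (w s y) + h s y)
            - (y' - y) *\<^sub>R (f' (w s y) (v s y) + dy h s y))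
          \<le> \<epsilon> * (K * ?k) + \<epsilon> * ?k + L * cmod (?\<delta> - (y' - y) *\<^sub>R v s y)"
          unfolding eq by (intro norm_triangle_mono 1 2 3)
        also have "\<dots> = \<epsilon> * (K + 1) * ?k + L * cmod (?\<delta> - (y' - y) *\<^sub>R v s y)"
          by (simp add: distrib_left distrib_right)
        finally show "cmod ((f (w s y') + h s y') - (f (w s y) + h s y)
            - (y' - y) *\<^sub>R (f' (w s y) (v s y) + dy h s y))
          \<le> \<epsilon> * (K + 1) * ?k + L * cmod (?\<delta> - (y' - y) *\<^sub>R v s y)" .
      next
        show "continuous_on {0..T'} (\<lambda>s. (f (w s y') + h s y') - (f (w s y) + h s y)
            - (y' - y) *\<^sub>R (f' (w s y) (v s y) + dy h s y))"
          by (intro continuous_on_diff continuous_on_scaleR continuous_on_const cont_G cont_G' y y')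
        show "continuous_on {0..T'} (\<lambda>s. w s y' - w s y - (y' - y) *\<^sub>R v s y)"
          by (intro continuous_on_diff continuous_on_scaleR continuous_on_const
              slice[OF w] slice[OF v] y y')
      qed (use T' L LT K \<epsilon> t in auto)
      also have "\<dots> = (\<epsilon> * c) * ?k" by (simp add: c_def algebra_simps)
      also have "\<epsilon> * c = e" using c by (simp add: \<epsilon>_def)
      finally show ?thesis .
    qed
    with d show "\<exists>d>0. \<forall>y'\<in>{-1..1}. norm (y' - y) < d \<longrightarrow>
        cmod (w t y' - w t y - (y' - y) *\<^sub>R v t y) \<le> e * norm (y' - y)"
      by auto
  qed

  have w_zero: "w t 0 = 0" if t: "t \<in> {0..T'}" for t
  proof -
    \<comment> \<open>Uniqueness in disguise: at \<open>y = 0\<close> the data vanish and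
      \<open>f 0 = 0\<close>, so both constants in \<open>volterra_bound\<close> are zero.\<close>
    have "cmod (w t 0) \<le> 2 * (0 + 0 * T')"
    proof (rule volterra_bound[where u = "\<lambda>s. w s 0" and g = "\<lambda>_. 0"
          and G = "\<lambda>s. f (w s 0) + h s 0"])
      fix s assume s: "s \<in> {0..T'}"
      show "w s 0 = 0 + integral {0..s} (\<lambda>s. f (w s 0) + h s 0)"
        using w_eq[OF s, of 0] zero(1) by simp
      show "cmod (f (w s 0) + h s 0) \<le> 0 + L * cmod (w s 0)"
        using f_lip[OF w_ball[OF s, of 0], of 0] zero(2)[of s] s T' R by (simp add: f_def)
    qed (use T' L LT t in \<open>auto intro!: slice[OF w] cont_G\<close>)
    then show ?thesis by simp
  qed
  show ?thesis
    using that[OF T' w v] w_eq v_eq w_der w_zero unfolding f_def f'_def by blast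
qed

section \<open>The lower bound for increments of the space derivative\<close>

text \<open>Measurability enters only through the continuous minorant \<open>g\<close>: monotonicity
  of the nonnegative integral holds for arbitrary functions, so \<open>G\<close> may be a supremum
  over uncountably many \<open>y\<close>.\<close>

lemma integral_le_set_nn_integral:
  fixes g :: "real \<Rightarrow> real" and G :: "real \<Rightarrow> ennreal"
  assumes cont: "continuous_on {0..t} g" and nonneg: "\<And>s. s \<in> {0..t} \<Longrightarrow> 0 \<le> g s"
    and le: "\<And>s. s \<in> {0..t} \<Longrightarrow> ennreal (g s) \<le> G s" and "t \<le> \<tau>"
    and fin: "(\<integral>\<^sup>+s\<in>{0..\<tau>}. G s \<partial>lborel) < \<infinity>"
  shows "integral {0..t} g \<le> enn2real (\<integral>\<^sup>+s\<in>{0..\<tau>}. G s \<partial>lborel)"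
proof -
  let ?g = "\<lambda>s. indicator {0..t} s *\<^sub>R g s"
  have "(g has_integral integral {0..t} g) {0..t}"
    by (intro integrable_integral integrable_continuous_real cont)
  then have "((\<lambda>s. if s \<in> {0..t} then g s else 0) has_integral integral {0..t} g) UNIV"
    by (simp only: has_integral_restrict_UNIV)
  also have "(\<lambda>s. if s \<in> {0..t} then g s else 0) = ?g"
    by (auto simp: indicator_def)
  finally have "(\<integral>\<^sup>+s. ennreal (?g s) \<partial>lborel) = ennreal (integral {0..t} g)"
    by (intro nn_integral_has_integral_lborel borel_measurable_continuous_on_indicator cont)
      (auto simp: indicator_def nonneg)
  moreover have "(\<integral>\<^sup>+s. ennreal (?g s) \<partial>lborel) \<le> (\<integral>\<^sup>+s\<in>{0..\<tau>}. G s \<partial>lborel)"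
    using le \<open>t \<le> \<tau>\<close> by (intro nn_integral_mono) (auto simp: indicator_def)
  ultimately have "ennreal (integral {0..t} g) \<le> (\<integral>\<^sup>+s\<in>{0..\<tau>}. G s \<partial>lborel)"
    by simp
  then show ?thesis
    using enn2real_mono[OF _ fin[unfolded infinity_ennreal_def]] integral_nonneg[OF _ nonneg]
      integrable_continuous_real[OF cont] by fastforce
qed

text \<open>A second derivative at \<open>0\<close> would force \<open>v y - v 0\<close> to be
  \<open>O(\<bar>y\<bar>)\<close>. Its quotient by \<open>\<bar>y\<bar> powr \<alpha>\<close> would
  then be \<open>O(\<bar>y\<bar> powr (1 - \<alpha>))\<close> and tend to \<open>0\<close>, against
  \<open>gap\<close>.\<close>

lemma not_twice_differentiable_at_0:
  fixes f v :: "real \<Rightarrow> complex"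
  assumes "\<alpha> < 1" "0 < c"
    and der: "\<And>y. y \<in> {-1..1} \<Longrightarrow> (f has_vector_derivative v y) (at y within {-1..1})"
    and gap: "\<forall>\<^sub>F y in at 0. c \<le> cmod (v y - v 0) / \<bar>y\<bar> powr \<alpha>"
  shows "\<not> twice_differentiable_at f 0"
proof
  assume "twice_differentiable_at f 0"
  then obtain D where D: "((\<lambda>y. vector_derivative f (at y)) has_vector_derivative D) (at 0)"
    unfolding twice_differentiable_at_def using vector_derivative_works by blast
  have eq: "vector_derivative f (at y) = v y" if "\<bar>y\<bar> < 1" for y
  proof (rule vector_derivative_at)
    have "(f has_vector_derivative v y) (at y within {-1..1})"
      using that by (intro der) auto
    moreover have "at y within {-1..1} = at y"
      using that by (intro at_within_Icc_at) auto
    ultimately show "(f has_vector_derivative v y) (at y)"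
      by simp
  qed
  \<comment> \<open>Error tolerance \<open>1\<close> suffices, as only a linear bound is
    wanted.\<close>
  have "\<exists>d>0. \<forall>y\<in>UNIV. norm (y - 0) < d \<longrightarrow>
      cmod (vector_derivative f (at y) - vector_derivative f (at 0) - (y - 0) *\<^sub>R D) \<le> 1 * norm (y - 0)"
    using D[unfolded has_vector_derivative_def has_derivative_within_alt]
    by (elim conjE allE[of _ 1]) simp
  then obtain d where d: "0 < d" "\<And>y. \<bar>y\<bar> < d \<Longrightarrow>
      cmod (vector_derivative f (at y) - vector_derivative f (at 0) - y *\<^sub>R D) \<le> \<bar>y\<bar>"
    by auto
  have small: "cmod (v y - v 0) \<le> (1 + cmod D) * \<bar>y\<bar>" if "\<bar>y\<bar> < min d 1" for y
  proof -
    have "cmod (v y - v 0 - y *\<^sub>R D) \<le> \<bar>y\<bar>"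
      using d(2)[of y] that by (simp add: eq)
    then show ?thesis
      using norm_triangle_sub[of "v y - v 0" "y *\<^sub>R D"] 
        by (simp add: distrib_right mult.commute[of "\<bar>y\<bar>" "cmod D"])
  qed
  \<comment> \<open>The limit is written in the form that the limit rules produce; it is
    \<open>0\<close>, since \<open>0 powr (1 - \<alpha>) = 0\<close>.\<close>
  have lim: "((\<lambda>y. (1 + cmod D) * \<bar>y\<bar> powr (1 - \<alpha>)) \<longlongrightarrow> (1 + cmod D) * \<bar>0\<bar> powr (1 - \<alpha>)) (at 0)"
    using \<open>\<alpha> < 1\<close>
    by (intro tendsto_mult tendsto_powr' tendsto_rabs tendsto_const tendsto_ident_at) simp_all
  then have "\<forall>\<^sub>F y in at 0. (1 + cmod D) * \<bar>y\<bar> powr (1 - \<alpha>) < c"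
    by (rule order_tendstoD) (use \<open>0 < c\<close> in simp)
  moreover have "\<forall>\<^sub>F y :: real in at 0. y \<noteq> 0 \<and> \<bar>y\<bar> < min d 1"
    using d(1) by (auto simp: eventually_at intro!: exI[of _ "min d 1"])
  ultimately have "\<forall>\<^sub>F y :: real in at 0. False"
    using gap
  proof eventually_elim
    case (elim y)
    have "cmod (v y - v 0) / \<bar>y\<bar> powr \<alpha> \<le> (1 + cmod D) * \<bar>y\<bar> / \<bar>y\<bar> powr \<alpha>"
      using small[of y] elim by (intro divide_right_mono) auto
    also have "\<dots> = (1 + cmod D) * \<bar>y\<bar> powr (1 - \<alpha>)"
      using elim by (simp add: powr_diff)
    finally show False using elim by simp
  qed
  then show False by simp
qed

text \<open>\<open>T\<close> and \<open>\<tau>\<close> are unrelated here: the lemma is applied on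
  the shortened time interval, while the integrability condition refers to the original one.\<close>

lemma derivative_gap:
  fixes lam :: complex and v w :: "real \<Rightarrow> real \<Rightarrow> complex"
  assumes \<alpha>: "0 < \<alpha>" "\<alpha> < 1" and lam: "lam \<noteq> 0" and T: "0 < T" and \<tau>: "0 < \<tau>" and \<beta>: "\<alpha> < \<beta>"
    and w: "C0_rect T w" and v: "C0_rect T v" and hy: "C0_rect T hy"
    and v0_lip: "\<And>y. y \<in> {-1..1} \<Longrightarrow> cmod (v0 y - v0 0) \<le> K * \<bar>y\<bar>" and v0: "v0 0 \<noteq> 0"
    and v_eq: "\<And>t y. t \<in> {0..T} \<Longrightarrow> y \<in> {-1..1} \<Longrightarrow>
       v t y = v0 y + integral {0..t} (\<lambda>s. lam * dpow \<alpha> (w s y) (v s y) + hy s y)"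
    and w_der: "\<And>t y. t \<in> {0..T} \<Longrightarrow> y \<in> {-1..1} \<Longrightarrow>
       (w t has_vector_derivative v t y) (at y within {-1..1})"
    and w_zero: "\<And>t. t \<in> {0..T} \<Longrightarrow> w t 0 = 0"
    and fin: "(\<integral>\<^sup>+t\<in>{0..\<tau>}. (SUP y\<in>{y. 0 < \<bar>y\<bar> \<and> \<bar>y\<bar> \<le> 1}.
          ennreal (cmod (hy t y - hy t 0) / \<bar>y\<bar> powr \<beta>)) \<partial>lborel) < \<infinity>"
  shows "\<forall>\<^sub>F t in at_right 0. \<exists>c>0. \<forall>\<^sub>F y in at 0. c \<le> cmod (v t y - v t 0) / \<bar>y\<bar> powr \<alpha>"
proof -
  define a where "a = v0 0"
  \<comment> \<open>The limit of the rescaled integrand; by \<open>dpow_self\<close> it is a nonzero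
    multiple of \<open>lam * a\<close>.\<close>
  define b where "b = lam * dpow \<alpha> a a"
  define I where "I = enn2real (\<integral>\<^sup>+t\<in>{0..\<tau>}. (SUP y\<in>{y. 0 < \<bar>y\<bar> \<and> \<bar>y\<bar> \<le> 1}.
          ennreal (cmod (hy t y - hy t 0) / \<bar>y\<bar> powr \<beta>)) \<partial>lborel)"
  have b: "b \<noteq> 0"
    using lam v0 \<alpha> by (simp add: b_def a_def dpow_self)
  have cont: "continuous_on UNIV (\<lambda>p. lam * dpow \<alpha> (fst p) (snd p) :: complex)"
    by (intro continuous_on_mult_left continuous_on_dpow[OF \<alpha>(1), unfolded case_prod_unfold])
  then have "isCont (\<lambda>p. lam * dpow \<alpha> (fst p) (snd p) :: complex) (a, a)"
    by (simp add: continuous_on_eq_continuous_at)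
  then obtain \<epsilon> where \<epsilon>: "0 < \<epsilon>" "\<And>q. dist q (a, a) < \<epsilon> \<Longrightarrow>
      dist (lam * dpow \<alpha> (fst q) (snd q)) b < cmod b / 2"
    unfolding continuous_at_eps_delta b_def[symmetric] using b
    by (metis b_def fst_conv snd_conv half_gt_zero zero_less_norm_iff)
  have near_b: "cmod (lam * dpow \<alpha> p q - b) \<le> cmod b / 2"
    if "cmod (p - a) \<le> \<epsilon> / 3" "cmod (q - a) \<le> \<epsilon> / 3" for p q
  proof -
    have "dist (p, q) (a, a) \<le> dist p a + dist q a"
      unfolding dist_Pair_Pair by (rule sqrt_sum_squares_le_sum) simp_all
    then have "dist (p, q) (a, a) < \<epsilon>" using that \<epsilon>(1) by (simp add: dist_norm)
    from \<epsilon>(2)[OF this] show ?thesis by (simp add: dist_norm)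
  qed
  have "v 0 0 = a" using v_eq[of 0 0] T by (simp add: a_def)
  moreover have "(0, 0) \<in> rect T" using T by simp
  ultimately obtain d0 where d0: "0 < d0"
    "\<And>p. p \<in> rect T \<Longrightarrow> dist p (0, 0) < d0 \<Longrightarrow> dist (v (fst p) (snd p)) a < \<epsilon> / 3"
    using v[unfolded C0_rect_def continuous_on_iff case_prod_unfold] \<epsilon>(1)
    by (metis fst_conv snd_conv divide_pos_pos zero_less_numeral)
  \<comment> \<open>Times and positions up to \<open>d\<close> have distance at most
    \<open>2 * d < d0\<close> from the origin; the other entries keep them inside the rectangle and
    inside \<open>{0..\<tau>}\<close>.\<close>
  define d where "d = min (d0 / 3) (min T (min \<tau> 1))"
  have d: "0 < d" "d \<le> T" "d \<le> \<tau>" "d \<le> 1" "2 * d < d0"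
    using d0(1) T \<tau> by (auto simp: d_def)
  have v_near: "cmod (v s y - a) \<le> \<epsilon> / 3" if "s \<in> {0..d}" "\<bar>y\<bar> \<le> d" for s y
  proof -
    have "dist (s, y) (0, 0) \<le> \<bar>s\<bar> + \<bar>y\<bar>"
      using sqrt_sum_squares_le_sum_abs[of s y] by (simp add: dist_Pair_Pair)
    then have "dist (s, y) (0, 0) < d0" using that d(5) by simp
    then show ?thesis
      using d0(2)[of "(s, y)"] that d by (simp add: dist_norm abs_le_iff)
  qed
  \<comment> \<open>The mean value inequality for \<open>w s y - y a\<close>, which vanishes at
    \<open>y = 0\<close>, turns closeness of \<open>v\<close> to \<open>a\<close> into closeness of
    \<open>w s y / y\<close> to \<open>a\<close>.\<close>
  have w_near: "cmod (w s y - y *\<^sub>R a) \<le> \<epsilon> / 3 * \<bar>y\<bar>" if s: "s \<in> {0..d}" and y: "\<bar>y\<bar> \<le> d" for s y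
  proof -
    have "cmod ((w s y - y *\<^sub>R a) - (w s 0 - 0 *\<^sub>R a)) \<le> \<epsilon> / 3 * \<bar>y - 0\<bar>"
    proof (rule has_vector_derivative_lipschitz[of "{-d..d}"])
      fix z assume z: "z \<in> {-d..d}"
      then have "(w s has_vector_derivative v s z) (at z within {-d..d})"
        using w_der[of s z] s d by (auto intro: has_vector_derivative_within_subset)
      then show "((\<lambda>y. w s y - y *\<^sub>R a) has_vector_derivative v s z - a) (at z within {-d..d})"
        by (auto intro!: derivative_eq_intros)
      show "cmod (v s z - a) \<le> \<epsilon> / 3"
        using z by (intro v_near s) auto
    qed (use y d in auto)
    then show ?thesis using w_zero[of s] s d by simp
  qed
  \<comment> \<open>The three terms on the left come from the nonlinearity, the initial datum and
    the source, each divided by \<open>\<bar>y\<bar> powr \<alpha>\<close>. The last two vanish as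
    \<open>y\<close> tends to \<open>0\<close>, because \<open>\<alpha> < 1\<close> and
    \<open>\<alpha> < \<beta>\<close>.\<close>
  have main: "t * cmod b / 2 - K * \<bar>y\<bar> powr (1 - \<alpha>) - I * \<bar>y\<bar> powr (\<beta> - \<alpha>)
      \<le> cmod (v t y - v t 0) / \<bar>y\<bar> powr \<alpha>"
    if t: "0 < t" "t \<le> d" and y: "y \<noteq> 0" "\<bar>y\<bar> \<le> d" for t y
  proof -
    have y1: "y \<in> {-1..1}" using y d by (auto simp: abs_le_iff)
    have tT: "t \<in> {0..T}" using t d by auto
    define J where "J = integral {0..t} (\<lambda>s. lam * dpow \<alpha> (w s y) (v s y))"
    define H where "H = integral {0..t} (\<lambda>s. hy s y - hy s 0)"
    have sub: "continuous_on {0..t} g" if "continuous_on {0..T} g" for g :: "real \<Rightarrow> complex"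
      using that tT by (auto intro: continuous_on_subset)
    have cont_dpow: "continuous_on {0..t} (\<lambda>s. lam * dpow \<alpha> (w s y) (v s y))"
    proof -
      have "continuous_on {0..t} (\<lambda>s. (\<lambda>p. lam * dpow \<alpha> (fst p) (snd p)) (w s y, v s y))"
        by (intro continuous_on_compose2[OF cont] continuous_on_Pair sub
            continuous_on_rect_slice[OF w y1] continuous_on_rect_slice[OF v y1]) auto
      then show ?thesis by simp
    qed
    have cont_hy: "continuous_on {0..t} (\<lambda>s. hy s z)" if "z \<in> {-1..1}" for z
      by (intro sub continuous_on_rect_slice[OF hy that])
    \<comment> \<open>At \<open>y = 0\<close> the nonlinear term drops out, since
      \<open>dpow\<close> vanishes where \<open>w\<close> does.\<close>
    have "v t 0 = v0 0 + integral {0..t} (\<lambda>s. hy s 0)"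
    proof -
      have "integral {0..t} (\<lambda>s. lam * dpow \<alpha> (w s 0) (v s 0) + hy s 0)
          = integral {0..t} (\<lambda>s. hy s 0)"
        using w_zero tT by (intro Henstock_Kurzweil_Integration.integral_cong) (auto simp: dpow_def)
      then show ?thesis using v_eq[OF tT, of 0] by simp
    qed
    moreover have "v t y = v0 y + (J + integral {0..t} (\<lambda>s. hy s y))"
      unfolding v_eq[OF tT y1] J_def
      by (subst Henstock_Kurzweil_Integration.integral_add)
        (auto intro!: integrable_continuous_real cont_dpow cont_hy y1)
    moreover have "H = integral {0..t} (\<lambda>s. hy s y) - integral {0..t} (\<lambda>s. hy s 0)"
      unfolding H_def
      by (subst Henstock_Kurzweil_Integration.integral_diff)
        (auto intro!: integrable_continuous_real cont_hy y1)
    ultimately have split: "v t y - v t 0 = J + H + (v0 y - v0 0)"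
      by simp
    have J: "t * cmod b / 2 * \<bar>y\<bar> powr \<alpha> \<le> cmod J"
    proof -
      \<comment> \<open>\<open>?b\<close> is the leading term of the integrand, \<open>?x\<close>
        the norm of its integral. The deviation is at most half as large, so \<open>J\<close>
        retains half of \<open>?x\<close>.\<close>
      let ?b = "\<bar>y\<bar> powr \<alpha> *\<^sub>R b" and ?x = "t * cmod b * \<bar>y\<bar> powr \<alpha>"
      have "cmod (integral {0..t} (\<lambda>s. lam * dpow \<alpha> (w s y) (v s y) - ?b))
          \<le> \<bar>y\<bar> powr \<alpha> * (cmod b / 2) * (t - 0)"
      proof (rule integral_bound)
        fix s assume "s \<in> {0..t}"
        then have s: "s \<in> {0..d}" using t by auto
        have "w s y /\<^sub>R y - a = (w s y - y *\<^sub>R a) /\<^sub>R y"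
          using y by (simp add: scaleR_right_diff_distrib)
        then have "cmod (w s y /\<^sub>R y - a) = cmod (w s y - y *\<^sub>R a) / \<bar>y\<bar>"
          by (simp add: divide_inverse mult.commute)
        then have "cmod (w s y /\<^sub>R y - a) \<le> \<epsilon> / 3"
          using w_near[OF s y(2)] y by (simp add: pos_divide_le_eq)
        from near_b[OF this v_near[OF s y(2)]]
        have *: "cmod (lam * dpow \<alpha> (w s y /\<^sub>R y) (v s y) - b) \<le> cmod b / 2" .
        have "dpow \<alpha> (w s y) (v s y) = \<bar>y\<bar> powr \<alpha> *\<^sub>R dpow \<alpha> (w s y /\<^sub>R y) (v s y)"
          using dpow_scaleR_left[OF y(1), of \<alpha> "w s y /\<^sub>R y"] y by simp
        then have "lam * dpow \<alpha> (w s y) (v s y) - ?b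
            = \<bar>y\<bar> powr \<alpha> *\<^sub>R (lam * dpow \<alpha> (w s y /\<^sub>R y) (v s y) - b)"
          by (simp add: scaleR_right_diff_distrib)
        then show "cmod (lam * dpow \<alpha> (w s y) (v s y) - ?b) \<le> \<bar>y\<bar> powr \<alpha> * (cmod b / 2)"
          using mult_left_mono[OF *, of "\<bar>y\<bar> powr \<alpha>"] by simp
      qed (use t in \<open>auto intro!: continuous_on_diff cont_dpow\<close>)
      moreover have "integral {0..t} (\<lambda>s. lam * dpow \<alpha> (w s y) (v s y) - ?b) = J - t *\<^sub>R ?b"
        unfolding J_def using t
        by (subst Henstock_Kurzweil_Integration.integral_diff)
          (auto intro!: integrable_continuous_real cont_dpow)
      ultimately have "cmod (J - t *\<^sub>R ?b) \<le> ?x / 2"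
        by (simp add: ac_simps)
      moreover have "cmod (t *\<^sub>R ?b) = ?x"
        using t by simp
      ultimately have "?x - ?x / 2 \<le> cmod J"
        using norm_triangle_ineq2[of "t *\<^sub>R ?b" J] norm_minus_commute[of J "t *\<^sub>R ?b"] by linarith
      then show ?thesis by simp
    qed
    have H: "cmod H \<le> I * \<bar>y\<bar> powr \<beta>"
    proof -
      \<comment> \<open>For the fixed \<open>y\<close>, the quotient lies below the supremum over
        all \<open>y\<close>, whose integral \<open>I\<close> is finite and independent of
        \<open>t\<close> and \<open>y\<close>.\<close>
      have "integral {0..t} (\<lambda>s. cmod (hy s y - hy s 0) / \<bar>y\<bar> powr \<beta>) \<le> I"
        unfolding I_def
      proof (rule integral_le_set_nn_integral[OF _ _ _ _ fin])
        show "ennreal (cmod (hy s y - hy s 0) / \<bar>y\<bar> powr \<beta>)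
          \<le> (SUP y\<in>{y. 0 < \<bar>y\<bar> \<and> \<bar>y\<bar> \<le> 1}. ennreal (cmod (hy s y - hy s 0) / \<bar>y\<bar> powr \<beta>))" for s
          using y d by (intro SUP_upper) auto
        show "continuous_on {0..t} (\<lambda>s. cmod (hy s y - hy s 0) / \<bar>y\<bar> powr \<beta>)"
          using y by (intro continuous_on_divide continuous_on_norm continuous_on_diff cont_hy y1
              continuous_on_const) auto
      qed (use t d in auto)
      then have "integral {0..t} (\<lambda>s. cmod (hy s y - hy s 0)) \<le> I * \<bar>y\<bar> powr \<beta>"
        using y by (simp add: pos_divide_le_eq)
      moreover have "cmod H \<le> integral {0..t} (\<lambda>s. cmod (hy s y - hy s 0))"
        unfolding H_def
        by (intro Henstock_Kurzweil_Integration.integral_norm_bound_integral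
            integrable_continuous_real continuous_on_norm continuous_on_diff cont_hy y1) auto
      ultimately show ?thesis by simp
    qed
    have "cmod J - cmod H - cmod (v0 y - v0 0) \<le> cmod (v t y - v t 0)"
      unfolding split using norm_diff_ineq[of J "H + (v0 y - v0 0)"]
        norm_triangle_ineq[of H "v0 y - v0 0"] by (simp add: add.assoc)
    then have "t * cmod b / 2 * \<bar>y\<bar> powr \<alpha> - I * \<bar>y\<bar> powr \<beta> - K * \<bar>y\<bar> \<le> cmod (v t y - v t 0)"
      using J H v0_lip[OF y1] by linarith
    from divide_right_mono[OF this, of "\<bar>y\<bar> powr \<alpha>"] show ?thesis
      using y by (simp add: diff_divide_distrib powr_diff)
  qed
  \<comment> \<open>The lower bound in \<open>main\<close> tends to \<open>t * cmod b / 2\<close>;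
    half of this limit is a valid bound near \<open>0\<close>.\<close>
  have gap: "\<forall>\<^sub>F y in at 0. t * cmod b / 4 \<le> cmod (v t y - v t 0) / \<bar>y\<bar> powr \<alpha>"
    if t: "0 < t" "t \<le> d" for t
  proof -
    have "((\<lambda>y. t * cmod b / 2 - K * \<bar>y\<bar> powr (1 - \<alpha>) - I * \<bar>y\<bar> powr (\<beta> - \<alpha>)) \<longlongrightarrow>
        t * cmod b / 2 - K * \<bar>0\<bar> powr (1 - \<alpha>) - I * \<bar>0\<bar> powr (\<beta> - \<alpha>)) (at 0)"
      using \<alpha> \<beta>
      by (intro tendsto_diff tendsto_mult tendsto_powr' tendsto_rabs tendsto_const tendsto_ident_at)
        simp_all
    then have "\<forall>\<^sub>F y in at 0. t * cmod b / 4
        < t * cmod b / 2 - K * \<bar>y\<bar> powr (1 - \<alpha>) - I * \<bar>y\<bar> powr (\<beta> - \<alpha>)"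
      by (rule order_tendstoD) (use t b in simp)
    moreover have "\<forall>\<^sub>F y :: real in at 0. y \<noteq> 0 \<and> \<bar>y\<bar> \<le> d"
      using d(1) by (auto simp: eventually_at intro!: exI[of _ d])
    ultimately show ?thesis
    proof eventually_elim
      case (elim y)
      then show ?case using main[OF t, of y] by linarith
    qed
  qed
  have "\<forall>\<^sub>F t in at_right 0. 0 < t \<and> t \<le> d"
    using d(1) by (auto simp: eventually_at_right_field intro!: exI[of _ d])
  then show ?thesis
  proof eventually_elim
    case (elim t)
    then show ?case using gap[of t] b by (intro exI[of _ "t * cmod b / 4"]) auto
  qed
qed

section \<open>Classical solution and its loss of regularity\<close>

theorem theorem2p1:
  fixes \<alpha> T :: real and lam :: complex
    and w0 :: "real \<Rightarrow> complex" and h :: "real \<Rightarrow> real \<Rightarrow> complex"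
  assumes "0 < \<alpha>" and "\<alpha> < 1" and "lam \<noteq> 0" and "T > 0"
    and "C2_on {-1..1} w0"
    and "C0_rect T h" and "dy_C0_rect T h"
    and "w0 0 = 0" and "\<And>t. t \<in> {0..T} \<Longrightarrow> h t 0 = 0"
  shows "\<exists>T' w. 0 < T' \<and> T' \<le> T \<and> is_solution \<alpha> lam T' w0 h w \<and>
    (\<forall>\<tau> \<beta>.
       vector_derivative w0 (at 0) \<noteq> 0 \<and> 0 < \<tau> \<and> \<tau> \<le> T \<and> \<beta> > \<alpha> \<and>
       (\<integral>\<^sup>+t\<in>{0..\<tau>}. (SUP y\<in>{y. 0 < \<bar>y\<bar> \<and> \<bar>y\<bar> \<le> 1}.
          ennreal (cmod (dy h t y - dy h t 0) / \<bar>y\<bar> powr \<beta>)) \<partial>lborel) < \<infinity>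
       \<longrightarrow>
       (\<forall>\<^sub>F t in at_right 0.
          Liminf (at 0) (\<lambda>y. ereal (cmod (dy w t y - dy w t 0) / \<bar>y\<bar> powr \<alpha>)) > 0) \<and>
       (\<forall>\<^sub>F t in at_right 0. \<not> twice_differentiable_at (w t) 0))"
proof -
  obtain w0' w0'' where
    w0': "\<And>y. y \<in> {-1..1} \<Longrightarrow> (w0 has_vector_derivative w0' y) (at y within {-1..1})" and
    w0'': "\<And>y. y \<in> {-1..1} \<Longrightarrow> (w0' has_vector_derivative w0'' y) (at y within {-1..1})" and
    cont: "continuous_on {-1..1} w0''"
    using assms(5) unfolding C2_on_def by blast
  have cont': "continuous_on {-1..1} w0'"
    using w0'' by (rule continuous_on_vector_derivative)
  show ?thesis
  proof (rule local_solution[where lam = lam, OF assms(1,4) w0' cont' assms(6-9)])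
    fix T' w v
    assume T': "0 < T'" "T' \<le> T" and w: "C0_rect T' w" and v: "C0_rect T' v"
      and w_eq: "\<And>t y. t \<in> {0..T'} \<Longrightarrow> y \<in> {-1..1} \<Longrightarrow>
         w t y = w0 y + integral {0..t} (\<lambda>s. lam * (cmod (w s y) powr \<alpha> *\<^sub>R w s y) + h s y)"
      and v_eq: "\<And>t y. t \<in> {0..T'} \<Longrightarrow> y \<in> {-1..1} \<Longrightarrow>
         v t y = w0' y + integral {0..t} (\<lambda>s. lam * dpow \<alpha> (w s y) (v s y) + dy h s y)"
      and w_der: "\<And>t y. t \<in> {0..T'} \<Longrightarrow> y \<in> {-1..1} \<Longrightarrow>
         (w t has_vector_derivative v t y) (at y within {-1..1})"
      and w_zero: "\<And>t. t \<in> {0..T'} \<Longrightarrow> w t 0 = 0"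
    have h: "C0_rect T' h" "C0_rect T' (dy h)"
      using assms(6,7) T' by (auto simp: dy_C0_rect_def intro: C0_rect_subset)
    define f where "f z = lam * (cmod z powr \<alpha> *\<^sub>R z)" for z
    have cont_f: "continuous_on S f" for S
    proof (rule has_derivative_continuous_on)
      show "(f has_derivative (\<lambda>v. lam * dpow \<alpha> z v)) (at z within S)" for z
        unfolding f_def
        by (intro has_derivative_mult_right has_derivative_norm_powr_scaleR assms(1))
    qed
    have rhs: "C0_rect T' (\<lambda>t y. f (w t y) + h t y)"
      unfolding C0_rect_def case_prod_unfold
      by (intro continuous_on_add continuous_on_compose2[OF cont_f]
          w[unfolded C0_rect_def case_prod_unfold] h(1)[unfolded C0_rect_def case_prod_unfold]) auto
    \<comment> \<open>The fundamental theorem of calculus, applied to the integral equation for each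
      fixed \<open>y\<close>.\<close>
    have w_dt: "((\<lambda>s. w s y) has_vector_derivative f (w t y) + h t y) (at t within {0..T'})"
      if t: "t \<in> {0..T'}" and y: "y \<in> {-1..1}" for t y
    proof -
      have "((\<lambda>s. integral {0..s} (\<lambda>s. f (w s y) + h s y)) has_vector_derivative
          f (w t y) + h t y) (at t within {0..T'})"
        by (intro integral_has_vector_derivative[OF continuous_on_rect_slice[OF rhs y] t])
      then have "((\<lambda>s. w0 y + integral {0..s} (\<lambda>s. f (w s y) + h s y)) has_vector_derivative
          f (w t y) + h t y) (at t within {0..T'})"
        by (auto intro!: derivative_eq_intros)
      then show ?thesis
        by (rule has_vector_derivative_transform[OF t, rotated]) (use w_eq y in \<open>simp add: f_def\<close>)
    qed
    have dt_w: "dt T' w t y = f (w t y) + h t y" if "t \<in> {0..T'}" "y \<in> {-1..1}" for t y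
      unfolding dt_def using T' by (intro vector_derivative_within_closed_interval w_dt that)
    have dy_w: "dy w t y = v t y" if "t \<in> {0..T'}" "y \<in> {-1..1}" for t y
      unfolding dy_def by (intro vector_derivative_within_closed_interval w_der that) simp
    have "dt_C0_rect T' w"
      unfolding dt_C0_rect_def
    proof
      show "\<forall>(t, y)\<in>rect T'. (\<lambda>s. w s y) differentiable at t within {0..T'}"
        using differentiableI_vector[OF w_dt] by auto
      show "C0_rect T' (dt T' w)"
        unfolding C0_rect_def
        by (rule continuous_on_eq[OF rhs[unfolded C0_rect_def]]) (auto simp: dt_w)
    qed
    moreover have "dy_C0_rect T' w"
      unfolding dy_C0_rect_def
    proof
      show "\<forall>(t, y)\<in>rect T'. w t differentiable at y within {-1..1}"
        using differentiableI_vector[OF w_der] by auto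
      show "C0_rect T' (dy w)"
        unfolding C0_rect_def
        by (rule continuous_on_eq[OF v[unfolded C0_rect_def]]) (auto simp: dy_w)
    qed
    moreover have "w 0 y = w0 y" if "y \<in> {-1..1}" for y
      using w_eq[of 0 y] that T' by simp
    ultimately have sol: "is_solution \<alpha> lam T' w0 h w"
      using w dt_w by (simp add: is_solution_def C1_rect_def f_def scaleR_conv_of_real mult.assoc)
    \<comment> \<open>A bound on \<open>w0''\<close> makes \<open>w0'\<close> Lipschitz, so the
      initial datum contributes only \<open>O(\<bar>y\<bar>)\<close>.\<close>
    obtain K where K: "\<And>y. y \<in> {-1..1} \<Longrightarrow> cmod (w0'' y) \<le> K"
      using compact_imp_bounded[OF compact_continuous_image[OF cont compact_Icc]]
      unfolding bounded_iff by fastforce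
    have w0'_lip: "cmod (w0' y - w0' 0) \<le> K * \<bar>y\<bar>" if "y \<in> {-1..1}" for y
      using has_vector_derivative_lipschitz[OF _ w0'' K, of 0 y] that by simp
    have w0'_0: "vector_derivative w0 (at 0) = w0' 0"
    proof (rule vector_derivative_at)
      have "at 0 within {-1..1 :: real} = at 0"
        by (intro at_within_Icc_at) auto
      then show "(w0 has_vector_derivative w0' 0) (at 0)"
        using w0'[of 0] by simp
    qed
    have "(\<forall>\<^sub>F t in at_right 0.
            Liminf (at 0) (\<lambda>y. ereal (cmod (dy w t y - dy w t 0) / \<bar>y\<bar> powr \<alpha>)) > 0) \<and>
         (\<forall>\<^sub>F t in at_right 0. \<not> twice_differentiable_at (w t) 0)"
      if "vector_derivative w0 (at 0) \<noteq> 0" "0 < \<tau>" "\<alpha> < \<beta>"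
        and fin: "(\<integral>\<^sup>+t\<in>{0..\<tau>}. (SUP y\<in>{y. 0 < \<bar>y\<bar> \<and> \<bar>y\<bar> \<le> 1}.
            ennreal (cmod (dy h t y - dy h t 0) / \<bar>y\<bar> powr \<beta>)) \<partial>lborel) < \<infinity>" for \<tau> \<beta>
    proof -
      have "\<forall>\<^sub>F t in at_right 0. \<exists>c>0. \<forall>\<^sub>F y in at 0. c \<le> cmod (v t y - v t 0) / \<bar>y\<bar> powr \<alpha>"
        using that w0'_0
        by (intro derivative_gap[OF assms(1-3) T'(1) _ _ w v h(2) w0'_lip _ v_eq w_der w_zero fin])
          auto
      moreover have "\<forall>\<^sub>F t in at_right 0. t \<in> {0..T'}"
        using T'(1) by (auto simp: eventually_at_right_field intro!: exI[of _ T'])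
      ultimately have "\<forall>\<^sub>F t in at_right 0.
          Liminf (at 0) (\<lambda>y. ereal (cmod (dy w t y - dy w t 0) / \<bar>y\<bar> powr \<alpha>)) > 0 \<and>
          \<not> twice_differentiable_at (w t) 0"
      proof eventually_elim
        case (elim t)
        then obtain c where c: "0 < c" "\<forall>\<^sub>F y in at 0. c \<le> cmod (v t y - v t 0) / \<bar>y\<bar> powr \<alpha>"
          by blast
        \<comment> \<open>\<open>dy w\<close> is identified with \<open>v\<close> only on the
          rectangle, whereas \<open>at 0\<close> ranges over all real \<open>y\<close>.\<close>
        have "\<forall>\<^sub>F y :: real in at 0. \<bar>y\<bar> \<le> 1"
          by (auto simp: eventually_at intro!: exI[of _ 1])
        with c(2) have "\<forall>\<^sub>F y in at 0. ereal c \<le> ereal (cmod (dy w t y - dy w t 0) / \<bar>y\<bar> powr \<alpha>)"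
          by eventually_elim (use elim(2) dy_w in \<open>simp add: abs_le_iff\<close>)
        then have "ereal c \<le> Liminf (at 0) (\<lambda>y. ereal (cmod (dy w t y - dy w t 0) / \<bar>y\<bar> powr \<alpha>))"
          by (rule Liminf_bounded)
        moreover have "\<not> twice_differentiable_at (w t) 0"
          by (rule not_twice_differentiable_at_0[OF assms(2) c(1) w_der[OF elim(2)] c(2)])
        ultimately show ?case
          using c(1) by (auto intro: less_le_trans[of 0 "ereal c"])
      qed
      then show ?thesis
        by (simp add: eventually_conj_iff)
    qed
    with T' sol show ?thesis by blast
  qed
qed

end
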